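(* The map $\varphi:M\to\mathbb P^{40-1}$ embeds $M$ into $\mathbb P^{40-1}$.
   Context: Everything is over $\mathbb C$. **The space $M$.** For $x=(x_1,x_2,x_3,x_4)\in\mathbb C^4$ also write $x$ for the $3\times 6$ matrix $$x=\begin{pmatrix}1&0&0&1&1&1\\0&1&0&1&x_1&x_2\\0&0&1&1&x_3&x_4\end{pmatrix}.$$ Put $D_1=x_1x_4-x_2x_3$, $D_2=x_1x_4-x_4+x_2-x_2x_3+x_3-x_1$, $Q=-x_1x_2x_3-x_2x_3x_4+x_2x_3+x_1x_2x_4+x_1x_3x_4-x_1x_4$, and $$D(x)=x_1x_2x_3x_4(x_1-1)(x_2-1)(x_3-1)(x_4-1)(x_1-x_2)(x_1-x_3)(x_2-x_4)(x_3-x_4)D_1D_2Q.$$ $M=\{x\in\mathbb C^4\mid D(x)\ne0\}$ is the moduli space of marked cubic surfaces: it is the space of $3\times6$ matrices whose columns give six points of $\mathbb P^2$, no three collinear and not all six on a conic, modulo $GL_3$ on the left and $(\mathbb C^\times)^6$ scaling the columns. **Labels.** $\mathcal A$ is the set of $40$ labels consisting of the $10$ labels $(abc,def)$ and the $30$ labels $(ab,cd,ef)$ with $\{a,b,c,d,e,f\}=\{1,\dots,6\}$, with identifications: in $(abc,def)$ the entries inside each triple may be permuted and the two triples interchanged; in $(ab,cd,ef)$ the entries inside each pair may be permuted and the three pairs may be cyclically permuted (but $(ab,cd,ef)\ne(ab,ef,cd)$). **The map $\varphi$.** For a $3\times6$ matrix $x=(x_{ij})$ let $D_{ijk}(x)$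 be the $3\times3$ minor on the columns $i,j,k$, always taken in increasing order (so $D_{ijk}$ does not depend on the order of the indices), and let $Q(x)$ here denote the determinant of the $6\times6$ matrix with columns $(x_{1j}x_{2j},\,x_{2j}x_{3j},\,x_{3j}x_{1j},\,x_{1j}^2,\,x_{2j}^2,\,x_{3j}^2)$, $j=1,\dots,6$. Define $$y_{(abc,def)}(x)=D_{abc}(x)D_{def}(x)Q(x),$$ $$y_{(ab,cd,ef)}(x)=D_{acd}(x)D_{bcd}(x)D_{cef}(x)D_{def}(x)D_{eab}(x)D_{fab}(x).$$ The map $\varphi:M\to\mathbb P^{40-1}$ sends $x$ to the point with homogeneous coordinates $(y_\alpha(x))_{\alpha\in\mathcal A}$. *)

theory Defs
  imports "HOL-Analysis.Analysis"
begin

definition poly_fun :: "(complex ^ 'n \<Rightarrow> complex) \<Rightarrow> bool" where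
  "poly_fun f \<longleftrightarrow> (\<exists>(S :: ('n \<Rightarrow> nat) set) c. finite S \<and>
     f = (\<lambda>x. \<Sum>m\<in>S. c m * (\<Prod>i\<in>UNIV. x $ i ^ m i)))"

definition homogeneous_fun :: "nat \<Rightarrow> (complex ^ 'n \<Rightarrow> complex) \<Rightarrow> bool" where
  "homogeneous_fun d f \<longleftrightarrow> (\<exists>(S :: ('n \<Rightarrow> nat) set) c. finite S \<and> (\<forall>m\<in>S. (\<Sum>i\<in>UNIV. m i) = d) \<and>
     f = (\<lambda>x. \<Sum>m\<in>S. c m * (\<Prod>i\<in>UNIV. x $ i ^ m i)))"

definition proj_rel :: "complex ^ 'n \<Rightarrow> complex ^ 'n \<Rightarrow> bool" where
  "proj_rel u v \<longleftrightarrow> u \<noteq> 0 \<and> v \<noteq> 0 \<and> (\<exists>c. c \<noteq> 0 \<and> v = c *s u)"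

lemma part_equivp_proj_rel: "part_equivp (proj_rel :: complex ^ 'n \<Rightarrow> _)"
proof (rule part_equivpI)
  show "\<exists>x :: complex ^ 'n. proj_rel x x"
    unfolding proj_rel_def
    by (intro exI[of _ "axis undefined 1"] conjI exI[of _ 1]) (auto simp: axis_eq_0_iff)
  show "symp (proj_rel :: complex ^ 'n \<Rightarrow> _)"
  proof (rule sympI)
    fix u v :: "complex ^ 'n" assume "proj_rel u v"
    then obtain c where c: "u \<noteq> 0" "v \<noteq> 0" "c \<noteq> 0" "v = c *s u"
      by (auto simp: proj_rel_def)
    then have "u = inverse c *s v" by (simp add: vector_smult_assoc)
    with c show "proj_rel v u" unfolding proj_rel_def by (metis inverse_nonzero_iff_nonzero)
  qed
  show "transp (proj_rel :: complex ^ 'n \<Rightarrow> _)"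
    by (rule transpI) (auto simp: proj_rel_def vector_smult_assoc)
qed

text \<open>The type \<open>'n proj\<close> is complex projective space of dimension \<open>CARD('n) - 1\<close>;
  \<open>proj_of v\<close> is the point with homogeneous coordinates \<open>v\<close>, meaningful for \<open>v \<noteq> 0\<close> only.\<close>

quotient_type 'n proj = "complex ^ 'n" / partial: proj_rel
  morphisms rep_proj proj_of
  by (rule part_equivp_proj_rel)

definition zariski_affine :: "(complex ^ 'n) topology" where
  "zariski_affine = topology_generated_by {{x. f x \<noteq> 0} | f. poly_fun f}"

definition zariski_proj :: "('n::finite proj) topology" where
  "zariski_proj =
     topology_generated_by {{proj_of v | v. v \<noteq> 0 \<and> f v \<noteq> 0} | f. \<exists>d. homogeneous_fun d f}"

definition locally_closed_in :: "'a topology \<Rightarrow> 'a set \<Rightarrow> bool" where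
  "locally_closed_in T Y \<longleftrightarrow> (\<exists>U C. openin T U \<and> closedin T C \<and> Y = U \<inter> C)"

definition regular_affine :: "(complex ^ 'n) set \<Rightarrow> (complex ^ 'n \<Rightarrow> complex) \<Rightarrow> bool" where
  "regular_affine W h \<longleftrightarrow> (\<forall>p\<in>W. \<exists>f g U. poly_fun f \<and> poly_fun g \<and>
     openin zariski_affine U \<and> p \<in> U \<and> (\<forall>x\<in>W \<inter> U. g x \<noteq> 0 \<and> h x = f x / g x))"

definition regular_proj :: "('n::finite proj) set \<Rightarrow> ('n proj \<Rightarrow> complex) \<Rightarrow> bool" where
  "regular_proj W h \<longleftrightarrow> (\<forall>p\<in>W. \<exists>d f g U. homogeneous_fun d f \<and> homogeneous_fun d g \<and>
     openin zariski_proj U \<and> p \<in> U \<and>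
     (\<forall>v. v \<noteq> 0 \<and> proj_of v \<in> W \<inter> U \<longrightarrow> g v \<noteq> 0 \<and> h (proj_of v) = f v / g v))"

text \<open>A space with functions: a topology together with a predicate telling which functions are
  regular on a given open set (only the values on that set matter).\<close>

type_synonym 'a fspace = "'a topology \<times> ('a set \<Rightarrow> ('a \<Rightarrow> complex) \<Rightarrow> bool)"

definition affine_subspace :: "(complex ^ 'n) set \<Rightarrow> (complex ^ 'n) fspace" where
  "affine_subspace W = (subtopology zariski_affine W, regular_affine)"

definition proj_subspace :: "('n::finite proj) set \<Rightarrow> ('n proj) fspace" where
  "proj_subspace Y = (subtopology zariski_proj Y, regular_proj)"

definition morphism :: "'a fspace \<Rightarrow> 'b fspace \<Rightarrow> ('a \<Rightarrow> 'b) \<Rightarrow> bool" where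
  "morphism X Y \<phi> \<longleftrightarrow> continuous_map (fst X) (fst Y) \<phi> \<and>
     (\<forall>V h. openin (fst Y) V \<and> snd Y V h \<longrightarrow> snd X {x \<in> topspace (fst X). \<phi> x \<in> V} (h \<circ> \<phi>))"

definition isomorphism :: "'a fspace \<Rightarrow> 'b fspace \<Rightarrow> ('a \<Rightarrow> 'b) \<Rightarrow> bool" where
  "isomorphism X Y \<phi> \<longleftrightarrow> morphism X Y \<phi> \<and>
     (\<exists>\<psi>. morphism Y X \<psi> \<and> (\<forall>x\<in>topspace (fst X). \<psi> (\<phi> x) = x) \<and>
          (\<forall>y\<in>topspace (fst Y). \<phi> (\<psi> y) = y))"

text \<open>Embedding in the sense of algebraic geometry: a locally closed immersion.\<close>

definition embeds_into_proj :: "(complex ^ 'n) set \<Rightarrow> (complex ^ 'n \<Rightarrow> 'm::finite proj) \<Rightarrow> bool" where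
  "embeds_into_proj W \<phi> \<longleftrightarrow> locally_closed_in zariski_proj (\<phi> ` W) \<and>
     isomorphism (affine_subspace W) (proj_subspace (\<phi> ` W)) \<phi>"

definition cubic_disc :: "complex ^ 4 \<Rightarrow> complex" where
  "cubic_disc x = (let x1 = x $ 1; x2 = x $ 2; x3 = x $ 3; x4 = x $ 4;
       D1 = x1*x4 - x2*x3;
       D2 = x1*x4 - x4 + x2 - x2*x3 + x3 - x1;
       Q = - x1*x2*x3 - x2*x3*x4 + x2*x3 + x1*x2*x4 + x1*x3*x4 - x1*x4
     in x1*x2*x3*x4 * (x1-1)*(x2-1)*(x3-1)*(x4-1) * (x1-x2)*(x1-x3)*(x2-x4)*(x3-x4) * D1*D2*Q)"

definition cubic_moduli :: "(complex ^ 4) set" where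
  "cubic_moduli = {x. cubic_disc x \<noteq> 0}"

definition config_matrix :: "complex ^ 4 \<Rightarrow> complex ^ 6 ^ 3" where
  "config_matrix x = vector
     [vector [1, 0, 0, 1, 1,     1],
      vector [0, 1, 0, 1, x $ 1, x $ 2],
      vector [0, 0, 1, 1, x $ 3, x $ 4]]"

text \<open>Columns are numbered by the natural numbers \<open>1, \<dots>, 6\<close>, since in the index type \<open>6\<close>
  the element \<open>6 = 0\<close> is the smallest one, which would spoil the increasing order of columns.\<close>

definition minor :: "nat set \<Rightarrow> complex ^ 6 ^ 3 \<Rightarrow> complex" where
  "minor T X = det (\<chi> r.
     (vector (map (\<lambda>j. X $ r $ of_nat j) (sorted_list_of_set T)) :: complex ^ 3))"

definition conic_det :: "complex ^ 6 ^ 3 \<Rightarrow> complex" where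
  "conic_det X = det (\<chi> r (j :: 6). (vector
      [X $ 1 $ j * X $ 2 $ j, X $ 2 $ j * X $ 3 $ j, X $ 3 $ j * X $ 1 $ j,
       (X $ 1 $ j)\<^sup>2, (X $ 2 $ j)\<^sup>2, (X $ 3 $ j)\<^sup>2] :: complex ^ 6) $ r)"

text \<open>The label \<open>(abc,def)\<close> is the set \<open>{{a,b,c},{d,e,f}}\<close>; the label \<open>(ab,cd,ef)\<close> is the set of
  the three cyclic rotations of the triple \<open>({a,b},{c,d},{e,f})\<close>.\<close>

definition rotations :: "'a \<Rightarrow> 'a \<Rightarrow> 'a \<Rightarrow> ('a \<times> 'a \<times> 'a) set" where
  "rotations A B C = {(A,B,C), (B,C,A), (C,A,B)}"

definition labels33 :: "nat set set set" where
  "labels33 = {{{a,b,c},{d,e,f}} | a b c d e f. {a,b,c,d,e,f} = {1..6}}"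

definition labels222 :: "(nat set \<times> nat set \<times> nat set) set set" where
  "labels222 = {rotations {a,b} {c,d} {e,f} | a b c d e f. {a,b,c,d,e,f} = {1..6}}"

lemma distinct6:
  assumes "{a,b,c,d,e,f} = {1..6::nat}"
  shows "distinct [a,b,c,d,e,f]"
  using assms by (intro card_distinct) simp

lemma labels33_eq: "labels33 = (\<lambda>T. {T, {1..6} - T}) ` {T. T \<subseteq> {1..6} \<and> 1 \<in> T \<and> card T = 3}"
proof (intro equalityI subsetI)
  fix L assume "L \<in> labels33"
  then obtain a b c d e f where L: "L = {{a,b,c},{d,e,f}}" and u: "{a,b,c,d,e,f} = {1..6}"
    unfolding labels33_def by auto
  note dist = distinct6[OF u]
  have 1: "{d,e,f} = {1..6} - {a,b,c}" "{a,b,c} = {1..6} - {d,e,f}"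
    unfolding u[symmetric] using dist by auto
  have 2: "card {a,b,c} = 3" "card {d,e,f} = 3" using dist by auto
  have 3: "{a,b,c} \<subseteq> {1..6}" "{d,e,f} \<subseteq> {1..6}" unfolding u[symmetric] by auto
  have "1 \<in> {a,b,c,d,e,f}" unfolding u by simp
  then have "1 \<in> {a,b,c} \<or> 1 \<in> {d,e,f}" by blast
  then show "L \<in> (\<lambda>T. {T, {1..6} - T}) ` {T. T \<subseteq> {1..6} \<and> 1 \<in> T \<and> card T = 3}"
  proof
    assume "1 \<in> {a,b,c}"
    moreover have "L = {{a,b,c}, {1..6} - {a,b,c}}" by (simp only: L 1(1))
    ultimately show ?thesis using 2(1) 3(1) by blast
  next
    assume "1 \<in> {d,e,f}"
    moreover have "L = {{d,e,f}, {1..6} - {d,e,f}}"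
      unfolding L 1(2)[symmetric] by (rule insert_commute)
    ultimately show ?thesis using 2(2) 3(2) by blast
  qed
next
  fix L :: "nat set set"
  assume "L \<in> (\<lambda>T. {T, {1..6} - T}) ` {T. T \<subseteq> {1..6} \<and> 1 \<in> T \<and> card T = 3}"
  then obtain T where T: "L = {T, {1..6} - T}" "T \<subseteq> {1..6}" "card T = 3" by auto
  then have "card ({1..6} - T) = 3" by (subst card_Diff_subset) (auto intro: finite_subset)
  then obtain d e f where "{1..6} - T = {d,e,f}" by (auto simp: card_3_iff)
  moreover obtain a b c where "T = {a,b,c}" using T by (auto simp: card_3_iff)
  moreover have "{1..6} = T \<union> ({1..6} - T)" using T by blast
  ultimately have "L = {{a,b,c},{d,e,f}}" "{a,b,c,d,e,f} = {1..6}" using T by auto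
  then show "L \<in> labels33" unfolding labels33_def by blast
qed

lemma labels222_eq:
  "labels222 = (\<lambda>(A,B). rotations A B ({1..6} - A - B)) `
     (SIGMA A:{A. A \<subseteq> {1..6} \<and> 1 \<in> A \<and> card A = 2}. {B. B \<subseteq> {1..6} - A \<and> card B = 2})"
  (is "_ = ?h ` ?S")
proof (intro equalityI subsetI)
  fix L assume "L \<in> labels222"
  then obtain a b c d e f where L: "L = rotations {a,b} {c,d} {e,f}" and u: "{a,b,c,d,e,f} = {1..6}"
    unfolding labels222_def by auto
  have *: "rotations {a,b} {c,d} {e,f} \<in> ?h ` ?S"
    if u: "{a,b,c,d,e,f} = {1..6}" and 1: "1 \<in> {a,b}" for a b c d e f
  proof -
    note dist = distinct6[OF u]
    have "{e,f} = {1..6} - {a,b} - {c,d}" "{a,b} \<subseteq> {1..6}" "{c,d} \<subseteq> {1..6} - {a,b}"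
      unfolding u[symmetric] using dist by auto
    moreover have "card {a,b} = 2" "card {c,d} = 2" using dist by auto
    ultimately show ?thesis using 1
      by (intro image_eqI[of _ _ "({a,b},{c,d})"])
        (simp_all only: mem_Sigma_iff mem_Collect_eq prod.case simp_thms)
  qed
  have rot: "rotations A B C = rotations B C A" for A B C :: "nat set"
    unfolding rotations_def by blast
  have "1 \<in> {a,b,c,d,e,f}" unfolding u by simp
  then consider "1 \<in> {a,b}" | "1 \<in> {c,d}" | "1 \<in> {e,f}" by blast
  then show "L \<in> ?h ` ?S"
  proof cases
    case 1
    then show ?thesis unfolding L by (intro * u)
  next
    case 2
    have "{c,d,e,f,a,b} = {1..6}" using u by (simp only: insert_commute)
    with 2 show ?thesis unfolding L rot[of "{a,b}"] by (intro *)
  next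
    case 3
    have "{e,f,a,b,c,d} = {1..6}" using u by (simp only: insert_commute)
    with 3 show ?thesis unfolding L rot[of "{e,f}", symmetric] by (intro *)
  qed
next
  fix L assume "L \<in> ?h ` ?S"
  then obtain A B where L: "L = rotations A B ({1..6} - A - B)"
    and A: "A \<subseteq> {1..6}" "card A = 2" and B: "B \<subseteq> {1..6} - A" "card B = 2" by auto
  have "finite B" using B by (intro finite_subset[OF B(1)]) simp
  then have "card ({1..6} - A - B) = 2" using A B
    by (subst card_Diff_subset, simp, simp, subst card_Diff_subset) (auto intro: finite_subset)
  then obtain e f where C: "{1..6} - A - B = {e,f}" by (auto simp: card_2_iff)
  obtain a b where ab: "A = {a,b}" using A by (auto simp: card_2_iff)
  obtain c d where cd: "B = {c,d}" using B by (auto simp: card_2_iff)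
  have "{1..6} = A \<union> B \<union> ({1..6} - A - B)" using A B by blast
  also have "\<dots> = {a,b,c,d,e,f}" unfolding C unfolding ab cd by auto
  finally have "{a,b,c,d,e,f} = {1..6}" by simp
  moreover have "L = rotations {a,b} {c,d} {e,f}" unfolding L C unfolding ab cd by simp
  ultimately show "L \<in> labels222" unfolding labels222_def by blast
qed

lemma card_subsets_with_1:
  "card {T. T \<subseteq> {1..6::nat} \<and> 1 \<in> T \<and> card T = Suc k} = 5 choose k"
proof -
  have "bij_betw (insert 1) {T. T \<subseteq> {2..6::nat} \<and> card T = k}
      {T. T \<subseteq> {1..6::nat} \<and> 1 \<in> T \<and> card T = Suc k}"
  proof (rule bij_betwI[where g = "\<lambda>T. T - {1}"])
    show "insert 1 \<in> {T. T \<subseteq> {2..6::nat} \<and> card T = k} \<rightarrow>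
        {T. T \<subseteq> {1..6::nat} \<and> 1 \<in> T \<and> card T = Suc k}"
    proof (intro Pi_I CollectI conjI)
      fix T assume T: "T \<in> {T. T \<subseteq> {2..6::nat} \<and> card T = k}"
      then have "finite T" "1 \<notin> T" by (auto intro: finite_subset)
      with T show "card (insert 1 T) = Suc k" by simp
    qed auto
    show "(\<lambda>T. T - {1}) \<in> {T. T \<subseteq> {1..6::nat} \<and> 1 \<in> T \<and> card T = Suc k} \<rightarrow>
        {T. T \<subseteq> {2..6::nat} \<and> card T = k}"
    proof (intro Pi_I CollectI conjI)
      fix T assume T: "T \<in> {T. T \<subseteq> {1..6::nat} \<and> 1 \<in> T \<and> card T = Suc k}"
      have "{1..6} - {1} = {2..6::nat}" by auto
      then show "T - {1} \<subseteq> {2..6}" using T by blast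
      show "card (T - {1}) = k" using T by (auto simp: card_Diff_singleton)
    qed
  qed auto
  from bij_betw_same_card[OF this] show ?thesis
    using n_subsets[of "{2..6::nat}" k] by simp
qed

lemma card_labels33: "card labels33 = 10"
proof -
  have "inj_on (\<lambda>T. {T, {1..6} - T}) {T. T \<subseteq> {1..6::nat} \<and> 1 \<in> T \<and> card T = 3}"
    by (intro inj_onI) (auto simp: doubleton_eq_iff)
  then show ?thesis
    unfolding labels33_eq using card_subsets_with_1[of 2]
    by (simp add: card_image eval_nat_numeral)
qed

lemma card_labels222: "card labels222 = 30"
proof -
  let ?A = "{A. A \<subseteq> {1..6::nat} \<and> 1 \<in> A \<and> card A = 2}"
  let ?S = "SIGMA A:?A. {B. B \<subseteq> {1..6} - A \<and> card B = 2}"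
  have "inj_on (\<lambda>(A,B). rotations A B ({1..6} - A - B)) ?S"
  proof (intro inj_onI, clarify)
    fix A B A' B' :: "nat set"
    assume *: "B \<subseteq> {1..6} - A" "1 \<in> A" "1 \<in> A'"
      "rotations A B ({1..6} - A - B) = rotations A' B' ({1..6} - A' - B')"
    have "(A', B', {1..6} - A' - B') \<in> rotations A B ({1..6} - A - B)"
      unfolding *(4) by (simp add: rotations_def)
    then consider "A' = A" "B' = B" | "A' = B" | "A' = {1..6} - A - B"
      unfolding rotations_def by blast
    then show "A = A' \<and> B = B'" using *(1-3) by cases blast+
  qed
  then have "card labels222 = card ?S"
    unfolding labels222_eq by (rule card_image)
  also have "\<dots> = (\<Sum>A\<in>?A. card {B. B \<subseteq> {1..6} - A \<and> card B = 2})"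
  proof (rule card_SigmaI)
    show "finite ?A" by (rule finite_subset[of _ "Pow {1..6}"], blast, simp)
    show "\<forall>A\<in>?A. finite {B. B \<subseteq> {1..6} - A \<and> card B = 2}"
    proof
      fix A :: "nat set"
      show "finite {B. B \<subseteq> {1..6} - A \<and> card B = 2}"
        by (rule finite_subset[of _ "Pow {1..6}"], blast, simp)
    qed
  qed
  also have "\<dots> = (\<Sum>A\<in>?A. 6)"
  proof (rule sum.cong[OF refl])
    fix A assume "A \<in> ?A"
    then have "card ({1..6} - A) = 4" by (subst card_Diff_subset) (auto intro: finite_subset)
    then show "card {B. B \<subseteq> {1..6} - A \<and> card B = 2} = 6"
      using n_subsets[of "{1..6} - A" 2] by (simp only: choose_two finite_Diff finite_atLeastAtMost)
  qed
  also have "\<dots> = 30"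
  proof -
    have "card ?A = 5"
      using card_subsets_with_1[of 1] unfolding Suc_1 by simp
    then show ?thesis by (simp only: sum_constant) simp
  qed
  finally show ?thesis .
qed

typedef label = "Inl ` labels33 \<union> Inr ` labels222"
proof -
  have "labels33 \<noteq> {}" using card_labels33 by (metis card.empty zero_neq_numeral)
  then show ?thesis by blast
qed

lemma card_label: "CARD(label) = 40"
proof -
  have "finite labels33" "finite labels222"
    using card_labels33 card_labels222 by (auto intro: card_ge_0_finite)
  then have "card (Inl ` labels33 \<union> Inr ` labels222) = 40"
    by (subst card_Un_disjoint) (auto simp: card_image card_labels33 card_labels222)
  then show ?thesis
    using type_definition.card[OF type_definition_label] by simp
qed

instance label :: finite
  by standard (rule card_ge_0_finite, simp add: card_label)

definition label33 :: "nat \<Rightarrow> nat \<Rightarrow> nat \<Rightarrow> nat \<Rightarrow> nat \<Rightarrow> nat \<Rightarrow> label" where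
  "label33 a b c d e f = Abs_label (Inl {{a,b,c},{d,e,f}})"

definition label222 :: "nat \<Rightarrow> nat \<Rightarrow> nat \<Rightarrow> nat \<Rightarrow> nat \<Rightarrow> nat \<Rightarrow> label" where
  "label222 a b c d e f = Abs_label (Inr (rotations {a,b} {c,d} {e,f}))"

text \<open>The products over the set representing a label make \<open>y\<close> independent of the way the label
  is written; \<open>ycoord_label33\<close> and \<open>ycoord_label222\<close> below give the explicit formulas.\<close>

definition ycoord :: "label \<Rightarrow> complex ^ 6 ^ 3 \<Rightarrow> complex" where
  "ycoord \<alpha> X = (case Rep_label \<alpha> of
      Inl S \<Rightarrow> (\<Prod>T\<in>S. minor T X) * conic_det X
    | Inr P \<Rightarrow> (\<Prod>(A,B,C)\<in>P. \<Prod>i\<in>A. minor (insert i B) X))"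

lemma ycoord_label33:
  assumes "{a,b,c,d,e,f} = {1..6}"
  shows "ycoord (label33 a b c d e f) X = minor {a,b,c} X * minor {d,e,f} X * conic_det X"
proof -
  have "{{a,b,c},{d,e,f}} \<in> labels33"
    using assms unfolding labels33_def by blast
  moreover have "{a,b,c} \<noteq> {d,e,f}"
    using distinct6[OF assms] by auto
  ultimately show ?thesis
    by (simp add: ycoord_def label33_def Abs_label_inverse)
qed

lemma prod_rotations:
  assumes "A \<noteq> B" "B \<noteq> C" "C \<noteq> A"
  shows "prod g (rotations A B C) = g (A,B,C) * (g (B,C,A) * g (C,A,B))"
  using assms unfolding rotations_def by auto

lemma ycoord_label222:
  assumes "{a,b,c,d,e,f} = {1..6}"
  shows "ycoord (label222 a b c d e f) X =
    minor {a,c,d} X * minor {b,c,d} X * minor {c,e,f} X * minor {d,e,f} X *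
    minor {e,a,b} X * minor {f,a,b} X"
proof -
  have mem: "rotations {a,b} {c,d} {e,f} \<in> labels222"
    using assms unfolding labels222_def by blast
  have ne: "{a,b} \<noteq> {c,d}" "{c,d} \<noteq> {e,f}" "{e,f} \<noteq> {a,b}"
    using distinct6[OF assms] by auto
  have "(\<Prod>(A,B,C)\<in>rotations {a,b} {c,d} {e,f}. \<Prod>i\<in>A. minor (insert i B) X) =
      (\<Prod>i\<in>{a,b}. minor (insert i {c,d}) X) * ((\<Prod>i\<in>{c,d}. minor (insert i {e,f}) X) *
      (\<Prod>i\<in>{e,f}. minor (insert i {a,b}) X))"
    by (simp only: prod_rotations[OF ne] prod.case)
  also have "\<dots> = minor {a,c,d} X * minor {b,c,d} X * minor {c,e,f} X * minor {d,e,f} X *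
    minor {e,a,b} X * minor {f,a,b} X"
    using distinct6[OF assms] by (simp add: mult.assoc)
  finally show ?thesis
    using mem by (simp add: ycoord_def label222_def Abs_label_inverse)
qed

lemma label_cases:
  obtains a b c d e f where "{a,b,c,d,e,f} = {1..6}" "\<alpha> = label33 a b c d e f"
  | a b c d e f where "{a,b,c,d,e,f} = {1..6}" "\<alpha> = label222 a b c d e f"
proof -
  consider S where "S \<in> labels33" "\<alpha> = Abs_label (Inl S)"
    | P where "P \<in> labels222" "\<alpha> = Abs_label (Inr P)"
    using Rep_label[of \<alpha>] Rep_label_inverse[of \<alpha>] by auto
  then show ?thesis
    using that unfolding labels33_def labels222_def label33_def label222_def by cases auto
qed

definition ycoords :: "complex ^ 6 ^ 3 \<Rightarrow> complex ^ label" where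
  "ycoords X = (\<chi> \<alpha>. ycoord \<alpha> X)"

lemma vector_6_nth:
  "(vector [a,b,c,d,e,f] :: 'a::zero ^ 6) $ 1 = a" "(vector [a,b,c,d,e,f] :: 'a ^ 6) $ 2 = b"
  "(vector [a,b,c,d,e,f] :: 'a ^ 6) $ 3 = c" "(vector [a,b,c,d,e,f] :: 'a ^ 6) $ 4 = d"
  "(vector [a,b,c,d,e,f] :: 'a ^ 6) $ 5 = e" "(vector [a,b,c,d,e,f] :: 'a ^ 6) $ 6 = f"
  by (simp_all add: vector_def)

lemma minor_sorted:
  assumes "i < j" "j < k"
  shows "minor {i,j,k} X = det (\<chi> r. (vector [X $ r $ of_nat i, X $ r $ of_nat j, X $ r $ of_nat k] :: complex ^ 3))"
proof -
  have "sorted_list_of_set {i,j,k} = [i,j,k]"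
    by (rule sorted_list_of_set.sorted_key_list_of_set_unique[THEN iffD1]) (use assms in auto)
  then show ?thesis by (simp add: minor_def)
qed

text \<open>Some homogeneous coordinate is nonzero, so \<open>phi\<close> below is well defined on \<open>cubic_moduli\<close>.\<close>

lemma ycoords_nonzero:
  assumes "x \<in> cubic_moduli"
  shows "ycoords (config_matrix x) \<noteq> 0"
proof -
  let ?X = "config_matrix x"
  have "cubic_disc x \<noteq> 0" using assms by (simp add: cubic_moduli_def)
  then have nz: "x $ 3 \<noteq> 0" "x $ 4 \<noteq> 0" "x $ 1 - x $ 2 \<noteq> 0"
    "x $ 1 * x $ 4 - x $ 4 + x $ 2 - x $ 2 * x $ 3 + x $ 3 - x $ 1 \<noteq> 0"
    unfolding cubic_disc_def Let_def mult_eq_0_iff de_Morgan_disj by blast+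
  have "minor {1,3,4} ?X = -1" "minor {2,3,4} ?X = 1" "minor {1,2,5} ?X = x $ 3"
    "minor {1,2,6} ?X = x $ 4" "minor {3,5,6} ?X = - (x $ 1 - x $ 2)"
    "minor {4,5,6} ?X = x $ 1 * x $ 4 - x $ 4 + x $ 2 - x $ 2 * x $ 3 + x $ 3 - x $ 1"
    by (simp_all add: minor_sorted det_3 config_matrix_def vector_6_nth algebra_simps)
  with nz have "minor {1,3,4} ?X \<noteq> 0" "minor {2,3,4} ?X \<noteq> 0" "minor {3,5,6} ?X \<noteq> 0"
    "minor {4,5,6} ?X \<noteq> 0" "minor {1,2,5} ?X \<noteq> 0" "minor {1,2,6} ?X \<noteq> 0"
    by (simp_all only: neg_equal_0_iff_equal) simp_all
  moreover have "{5,1,2} = {1,2,5::nat}" "{6,1,2} = {1,2,6::nat}" by auto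
  moreover have "{1,2,3,4,5,6} = {1..6::nat}" by auto
  ultimately have "ycoords ?X $ label222 1 2 3 4 5 6 \<noteq> 0"
    by (simp add: ycoords_def ycoord_label222)
  then show ?thesis by auto
qed

definition phi :: "complex ^ 4 \<Rightarrow> label proj" where
  "phi x = proj_of (ycoords (config_matrix x))"

end

theory Submission
  imports Defs
begin

text \<open>
  Why \<open>phi\<close> is an embedding. The source is the complement of a hypersurface in affine space and
  the homogeneous coordinates of \<open>phi\<close> are polynomials. For such a map it suffices to write every
  affine coordinate of the source as a quotient of two forms of equal degree in the homogeneous
  coordinates of the image point, with a denominator that vanishes nowhere on the source
  (\<open>embeds_into_projI\<close>): these quotients give a regular inverse, and they also turn membership in
  the image into polynomial equations and inequations, so that the image is locally closed.

  Functions with such a representation form a ring (\<open>forms_ratio\<close>). On the moduli space no three of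
  the six points are collinear and the six do not lie on a conic, so all forty coordinates \<open>y\<close> of
  \<open>phi\<close> are nowhere zero (\<open>ycoords_nth_nonzero\<close>), and the ring contains every Laurent monomial of
  degree zero in them.

  It remains to find \<open>x1, ..., x4\<close> in that ring (\<open>forms_ratio_coordinate\<close>). They are not Laurent
  monomials in the \<open>y\<close> themselves. Up to sign every \<open>y\<close> is a product of the fifteen factors of the
  discriminant; give the factors \<open>x2, x3, x1 - 1, x4 - 1\<close> weight 1, the factors
  \<open>x1, x4, x2 - 1, x3 - 1\<close> weight 2, and the remaining ones weight 0. Then every \<open>y\<close> has weight
  divisible by 3, whereas no \<open>xi\<close> has. The functions \<open>x1 - x2\<close>, \<open>x1 - x3\<close>, \<open>x2 - x4\<close>, \<open>x1 x2\<close>,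
  \<open>x1 (x1 - 1)\<close> and \<open>x2 (x2 - 1)\<close> have weight divisible by 3, and they are Laurent monomials of degree
  zero in the \<open>y\<close> up to sign. Addition recovers the coordinates from them, since
  \<open>x1 + x2 = (x1 - x2)^2 + 2 x1 x2 - x1 (x1 - 1) - x2 (x2 - 1)\<close>.
\<close>

section \<open>Polynomial and homogeneous functions\<close>

text \<open>Polynomial functions and forms of degree \<open>d\<close> are both linear combinations of monomials with
  exponents in a prescribed set, so their closure properties have a common proof.\<close>

definition monomial_comb :: "('n \<Rightarrow> nat) set \<Rightarrow> (complex ^ 'n \<Rightarrow> complex) \<Rightarrow> bool" where
  "monomial_comb E f \<longleftrightarrow> (\<exists>S c. finite S \<and> S \<subseteq> E \<and>
     f = (\<lambda>x. \<Sum>m\<in>S. c m * (\<Prod>i\<in>UNIV. x $ i ^ m i)))"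

lemma poly_fun_iff_monomial_comb: "poly_fun f \<longleftrightarrow> monomial_comb UNIV f"
  by (simp add: poly_fun_def monomial_comb_def)

lemma homogeneous_fun_iff_monomial_comb:
  "homogeneous_fun d f \<longleftrightarrow> monomial_comb {m. (\<Sum>i\<in>UNIV. m i) = d} f"
  by (simp add: homogeneous_fun_def monomial_comb_def subset_iff Ball_def)

lemma monomial_comb_single:
  assumes "m \<in> E"
  shows "monomial_comb E (\<lambda>x. a * (\<Prod>i\<in>UNIV. x $ i ^ m i))"
  unfolding monomial_comb_def
  by (rule exI[of _ "{m}"], rule exI[of _ "\<lambda>_. a"]) (use assms in simp)

lemma monomial_comb_add:
  assumes "monomial_comb E f" "monomial_comb E g"
  shows "monomial_comb E (\<lambda>x. f x + g x)"
proof -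
  obtain S c where S: "finite S" "S \<subseteq> E" and f: "f = (\<lambda>x. \<Sum>m\<in>S. c m * (\<Prod>i\<in>UNIV. x $ i ^ m i))"
    using assms(1) unfolding monomial_comb_def by blast
  obtain T e where T: "finite T" "T \<subseteq> E" and g: "g = (\<lambda>x. \<Sum>m\<in>T. e m * (\<Prod>i\<in>UNIV. x $ i ^ m i))"
    using assms(2) unfolding monomial_comb_def by blast
  define k where "k m = (if m \<in> S then c m else 0) + (if m \<in> T then e m else 0)" for m
  have "f x + g x = (\<Sum>m\<in>S \<union> T. k m * (\<Prod>i\<in>UNIV. x $ i ^ m i))" for x
  proof -
    have 1: "f x = (\<Sum>m\<in>S \<union> T. (if m \<in> S then c m else 0) * (\<Prod>i\<in>UNIV. x $ i ^ m i))"
      unfolding f using S(1) T(1) by (intro sum.mono_neutral_cong_left) auto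
    have 2: "g x = (\<Sum>m\<in>S \<union> T. (if m \<in> T then e m else 0) * (\<Prod>i\<in>UNIV. x $ i ^ m i))"
      unfolding g using S(1) T(1) by (intro sum.mono_neutral_cong_left) auto
    show ?thesis unfolding 1 2 k_def by (simp only: sum.distrib[symmetric] distrib_right)
  qed
  then show ?thesis
    unfolding monomial_comb_def using S T
    by (intro exI[of _ "S \<union> T"] exI[of _ k]) auto
qed

lemma monomial_comb_zero: "monomial_comb E (\<lambda>x. 0)"
  unfolding monomial_comb_def by (rule exI[of _ "{}"]) simp

lemma monomial_comb_sum:
  assumes "\<And>j. j \<in> J \<Longrightarrow> monomial_comb E (f j)"
  shows "monomial_comb E (\<lambda>x. \<Sum>j\<in>J. f j x)"
  using assms
  by (induction J rule: infinite_finite_induct) (auto intro: monomial_comb_zero monomial_comb_add)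

lemma monomial_comb_mult:
  assumes "monomial_comb E f" "monomial_comb E' g"
    and "\<And>m m'. m \<in> E \<Longrightarrow> m' \<in> E' \<Longrightarrow> (\<lambda>i. m i + m' i) \<in> E''"
  shows "monomial_comb E'' (\<lambda>x. f x * g x)"
proof -
  obtain S c where S: "finite S" "S \<subseteq> E" and f: "f = (\<lambda>x. \<Sum>m\<in>S. c m * (\<Prod>i\<in>UNIV. x $ i ^ m i))"
    using assms(1) unfolding monomial_comb_def by blast
  obtain T e where T: "finite T" "T \<subseteq> E'" and g: "g = (\<lambda>x. \<Sum>m\<in>T. e m * (\<Prod>i\<in>UNIV. x $ i ^ m i))"
    using assms(2) unfolding monomial_comb_def by blast
  have "(\<lambda>x. f x * g x) = (\<lambda>x. \<Sum>m\<in>S. \<Sum>m'\<in>T. (c m * e m') * (\<Prod>i\<in>UNIV. x $ i ^ (m i + m' i)))"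
    unfolding f g by (simp add: sum_product power_add prod.distrib mult_ac)
  moreover have "monomial_comb E'' (\<lambda>x. (c m * e m') * (\<Prod>i\<in>UNIV. x $ i ^ (m i + m' i)))"
    if "m \<in> S" "m' \<in> T" for m m'
    using monomial_comb_single[OF assms(3), of m m' "c m * e m'"] that S T by auto
  ultimately show ?thesis by (simp add: monomial_comb_sum)
qed

lemma homogeneous_fun_add:
  "homogeneous_fun d f \<Longrightarrow> homogeneous_fun d g \<Longrightarrow> homogeneous_fun d (\<lambda>v. f v + g v)"
  unfolding homogeneous_fun_iff_monomial_comb by (rule monomial_comb_add)

lemma homogeneous_fun_mult:
  "homogeneous_fun d f \<Longrightarrow> homogeneous_fun e g \<Longrightarrow> homogeneous_fun (d + e) (\<lambda>v. f v * g v)"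
  unfolding homogeneous_fun_iff_monomial_comb by (erule monomial_comb_mult) (auto simp: sum.distrib)

lemma homogeneous_fun_const: "homogeneous_fun 0 (\<lambda>v. a)"
  using monomial_comb_single[of "\<lambda>_. 0" "{m. (\<Sum>i\<in>UNIV. m i) = 0}" a]
  by (simp add: homogeneous_fun_iff_monomial_comb)

lemma homogeneous_fun_diff:
  assumes "homogeneous_fun d f" "homogeneous_fun d g"
  shows "homogeneous_fun d (\<lambda>v. f v - g v)"
proof -
  have "homogeneous_fun (0 + d) (\<lambda>v. - 1 * g v)"
    by (intro homogeneous_fun_mult homogeneous_fun_const assms)
  then have "homogeneous_fun d (\<lambda>v. f v + - 1 * g v)"
    using assms(1) by (intro homogeneous_fun_add) simp_all
  then show ?thesis by simp
qed

lemma monomial_indicator: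
  fixes x :: "complex ^ 'n"
  shows "(\<Prod>i\<in>UNIV. x $ i ^ (if i = k then 1 else 0)) = x $ k"
  by (subst prod.remove[of _ k]) (auto intro: prod.neutral)

lemma homogeneous_fun_nth: "homogeneous_fun 1 (\<lambda>v. v $ k)"
proof -
  have "monomial_comb {m. (\<Sum>i\<in>UNIV. m i) = 1} (\<lambda>v :: complex ^ 'a. 1 * (\<Prod>i\<in>UNIV. v $ i ^ (if i = k then 1 else 0)))"
    by (rule monomial_comb_single) simp
  then show ?thesis unfolding homogeneous_fun_iff_monomial_comb monomial_indicator by simp
qed

lemma homogeneous_fun_prod:
  assumes "\<And>j. j \<in> J \<Longrightarrow> homogeneous_fun (d j) (f j)"
  shows "homogeneous_fun (\<Sum>j\<in>J. d j) (\<lambda>v. \<Prod>j\<in>J. f j v)"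
  using assms
  by (induction J rule: infinite_finite_induct)
     (auto intro: homogeneous_fun_const homogeneous_fun_mult)

lemma homogeneous_fun_scale:
  assumes "homogeneous_fun d f"
  shows "f (c *s v) = c ^ d * f v"
proof -
  obtain S a where S: "\<forall>m\<in>S. (\<Sum>i\<in>UNIV. m i) = d"
    and f: "f = (\<lambda>x. \<Sum>m\<in>S. a m * (\<Prod>i\<in>UNIV. x $ i ^ m i))"
    using assms unfolding homogeneous_fun_def by blast
  show ?thesis unfolding f sum_distrib_left
    by (rule sum.cong) (use S in \<open>auto simp: power_mult_distrib prod.distrib power_sum[symmetric]\<close>)
qed

lemma poly_fun_add: "poly_fun f \<Longrightarrow> poly_fun g \<Longrightarrow> poly_fun (\<lambda>x. f x + g x)"
  unfolding poly_fun_iff_monomial_comb by (rule monomial_comb_add)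

lemma poly_fun_mult: "poly_fun f \<Longrightarrow> poly_fun g \<Longrightarrow> poly_fun (\<lambda>x. f x * g x)"
  unfolding poly_fun_iff_monomial_comb by (erule monomial_comb_mult) auto

lemma poly_fun_const: "poly_fun (\<lambda>x. a)"
  using monomial_comb_single[of "\<lambda>_. 0" UNIV a] by (simp add: poly_fun_iff_monomial_comb)

lemma poly_fun_nth: "poly_fun (\<lambda>x. x $ k)"
  using homogeneous_fun_nth[of k] unfolding homogeneous_fun_def poly_fun_def by blast

lemma poly_fun_uminus:
  assumes "poly_fun f"
  shows "poly_fun (\<lambda>x. - f x)"
proof -
  have "poly_fun (\<lambda>x. - 1 * f x)" by (intro poly_fun_mult poly_fun_const assms)
  then show ?thesis by simp
qed

lemma poly_fun_diff:
  assumes "poly_fun f" "poly_fun g"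
  shows "poly_fun (\<lambda>x. f x - g x)"
proof -
  have "poly_fun (\<lambda>x. f x + - g x)" by (intro poly_fun_add poly_fun_uminus assms)
  then show ?thesis by simp
qed

lemma poly_fun_sum: "(\<And>j. j \<in> J \<Longrightarrow> poly_fun (f j)) \<Longrightarrow> poly_fun (\<lambda>x. \<Sum>j\<in>J. f j x)"
  unfolding poly_fun_iff_monomial_comb by (rule monomial_comb_sum)

lemma poly_fun_prod:
  assumes "\<And>j. j \<in> J \<Longrightarrow> poly_fun (f j)"
  shows "poly_fun (\<lambda>x. \<Prod>j\<in>J. f j x)"
  using assms
  by (induction J rule: infinite_finite_induct) (auto intro: poly_fun_const poly_fun_mult)

lemma poly_fun_power: "poly_fun f \<Longrightarrow> poly_fun (\<lambda>x. f x ^ n)"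
  by (induction n) (auto intro: poly_fun_const poly_fun_mult)

lemma poly_fun_det:
  assumes "\<And>r j. poly_fun (\<lambda>x. A x $ r $ j)"
  shows "poly_fun (\<lambda>x. det (A x))"
  unfolding det_def by (intro poly_fun_sum poly_fun_mult poly_fun_const poly_fun_prod assms)

lemma homogeneous_fun_imp_poly_fun: "homogeneous_fun d f \<Longrightarrow> poly_fun f"
  unfolding homogeneous_fun_def poly_fun_def by blast

lemma poly_fun_compose:
  assumes "poly_fun f" "\<And>i. poly_fun (\<lambda>x. Y x $ i)"
  shows "poly_fun (\<lambda>x. f (Y x))"
proof -
  obtain S c where f: "f = (\<lambda>x. \<Sum>m\<in>S. c m * (\<Prod>i\<in>UNIV. x $ i ^ m i))"
    using assms(1) unfolding poly_fun_def by blast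
  show ?thesis unfolding f
    by (intro poly_fun_sum poly_fun_mult poly_fun_const poly_fun_prod poly_fun_power assms)
qed

section \<open>Quotients of forms of the same degree\<close>

text \<open>Two cases motivate the parameter \<open>Y\<close>. If \<open>Y\<close> gives homogeneous coordinates of a map from \<open>W\<close>
  to projective space, these are pullbacks of functions that are a single fraction of forms. If \<open>Y\<close>
  is the identity, they are degree zero fractions on a subset \<open>W\<close> of the affine cone.\<close>

definition forms_ratio :: "'a set \<Rightarrow> ('a \<Rightarrow> complex ^ 'm) \<Rightarrow> ('a \<Rightarrow> complex) \<Rightarrow> bool" where
  "forms_ratio W Y r \<longleftrightarrow> (\<exists>d f g. homogeneous_fun d f \<and> homogeneous_fun d g \<and>
     (\<forall>x\<in>W. g (Y x) \<noteq> 0 \<and> r x = f (Y x) / g (Y x)))"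

lemma forms_ratio_cong:
  "forms_ratio W Y r \<Longrightarrow> (\<And>x. x \<in> W \<Longrightarrow> r' x = r x) \<Longrightarrow> forms_ratio W Y r'"
  unfolding forms_ratio_def by auto

lemma forms_ratio_const: "forms_ratio W Y (\<lambda>x. a)"
  unfolding forms_ratio_def
  by (rule exI[of _ 0], rule exI[of _ "\<lambda>_. a"], rule exI[of _ "\<lambda>_. 1"])
     (simp add: homogeneous_fun_const)

lemma forms_ratio_add:
  assumes "forms_ratio W Y r" "forms_ratio W Y s"
  shows "forms_ratio W Y (\<lambda>x. r x + s x)"
proof -
  obtain d f g where 1: "homogeneous_fun d f" "homogeneous_fun d g"
    "\<forall>x\<in>W. g (Y x) \<noteq> 0 \<and> r x = f (Y x) / g (Y x)"
    using assms(1) unfolding forms_ratio_def by blast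
  obtain e k l where 2: "homogeneous_fun e k" "homogeneous_fun e l"
    "\<forall>x\<in>W. l (Y x) \<noteq> 0 \<and> s x = k (Y x) / l (Y x)"
    using assms(2) unfolding forms_ratio_def by blast
  have "homogeneous_fun (d + e) (\<lambda>v. f v * l v + g v * k v)" "homogeneous_fun (d + e) (\<lambda>v. g v * l v)"
    by (intro homogeneous_fun_add homogeneous_fun_mult 1 2)+
  moreover have "g (Y x) * l (Y x) \<noteq> 0 \<and>
      r x + s x = (f (Y x) * l (Y x) + g (Y x) * k (Y x)) / (g (Y x) * l (Y x))" if "x \<in> W" for x
    using bspec[OF 1(3) that] bspec[OF 2(3) that] by (simp add: field_simps)
  ultimately show ?thesis unfolding forms_ratio_def by blast
qed

lemma forms_ratio_mult:
  assumes "forms_ratio W Y r" "forms_ratio W Y s"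
  shows "forms_ratio W Y (\<lambda>x. r x * s x)"
proof -
  obtain d f g where 1: "homogeneous_fun d f" "homogeneous_fun d g"
    "\<forall>x\<in>W. g (Y x) \<noteq> 0 \<and> r x = f (Y x) / g (Y x)"
    using assms(1) unfolding forms_ratio_def by blast
  obtain e k l where 2: "homogeneous_fun e k" "homogeneous_fun e l"
    "\<forall>x\<in>W. l (Y x) \<noteq> 0 \<and> s x = k (Y x) / l (Y x)"
    using assms(2) unfolding forms_ratio_def by blast
  have "homogeneous_fun (d + e) (\<lambda>v. f v * k v)" "homogeneous_fun (d + e) (\<lambda>v. g v * l v)"
    by (intro homogeneous_fun_mult 1 2)+
  moreover have "g (Y x) * l (Y x) \<noteq> 0 \<and>
      r x * s x = (f (Y x) * k (Y x)) / (g (Y x) * l (Y x))" if "x \<in> W" for x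
    using bspec[OF 1(3) that] bspec[OF 2(3) that] by simp
  ultimately show ?thesis unfolding forms_ratio_def by blast
qed

lemma forms_ratio_diff:
  assumes "forms_ratio W Y r" "forms_ratio W Y s"
  shows "forms_ratio W Y (\<lambda>x. r x - s x)"
proof -
  have "forms_ratio W Y (\<lambda>x. r x + - 1 * s x)"
    by (intro forms_ratio_add forms_ratio_mult forms_ratio_const assms)
  then show ?thesis by simp
qed

lemma forms_ratio_nth:
  assumes "\<And>x. x \<in> W \<Longrightarrow> Y x $ \<beta> \<noteq> 0"
  shows "forms_ratio W Y (\<lambda>x. Y x $ \<alpha> / Y x $ \<beta>)"
  unfolding forms_ratio_def
  by (rule exI[of _ 1], rule exI[of _ "\<lambda>v. v $ \<alpha>"], rule exI[of _ "\<lambda>v. v $ \<beta>"])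
     (simp add: homogeneous_fun_nth[simplified] assms)

lemma forms_ratio_sum:
  assumes "\<And>j. j \<in> J \<Longrightarrow> forms_ratio W Y (r j)"
  shows "forms_ratio W Y (\<lambda>x. \<Sum>j\<in>J. r j x)"
  using assms
  by (induction J rule: infinite_finite_induct) (auto intro: forms_ratio_const forms_ratio_add)

lemma forms_ratio_prod:
  assumes "\<And>j. j \<in> J \<Longrightarrow> forms_ratio W Y (r j)"
  shows "forms_ratio W Y (\<lambda>x. \<Prod>j\<in>J. r j x)"
  using assms
  by (induction J rule: infinite_finite_induct) (auto intro: forms_ratio_const forms_ratio_mult)

lemma forms_ratio_power: "forms_ratio W Y r \<Longrightarrow> forms_ratio W Y (\<lambda>x. r x ^ n)"
  by (induction n) (auto intro: forms_ratio_const forms_ratio_mult)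

lemma forms_ratio_poly_fun:
  assumes "poly_fun P" "\<And>i. forms_ratio W Y (\<lambda>x. r x $ i)"
  shows "forms_ratio W Y (\<lambda>x. P (r x))"
proof -
  obtain S c where P: "P = (\<lambda>x. \<Sum>m\<in>S. c m * (\<Prod>i\<in>UNIV. x $ i ^ m i))"
    using assms(1) unfolding poly_fun_def by blast
  show ?thesis unfolding P
    by (intro forms_ratio_sum forms_ratio_mult forms_ratio_const forms_ratio_prod forms_ratio_power assms)
qed

section \<open>Zariski topologies\<close>

lemma openin_zariski_affine_basic: "poly_fun f \<Longrightarrow> openin zariski_affine {x. f x \<noteq> 0}"
  unfolding zariski_affine_def by (rule topology_generated_by_Basis) blast

lemma topspace_zariski_affine [simp]: "topspace zariski_affine = UNIV"
  using openin_subset[OF openin_zariski_affine_basic[OF poly_fun_const[of 1]]] by auto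

lemma proj_of_cases:
  obtains v where "v \<noteq> 0" "p = proj_of v"
  using Quotient_abs_rep[OF Quotient_proj, of p] Quotient_rep_reflp[OF Quotient_proj, of p]
  unfolding proj_rel_def by metis

lemma proj_of_eq_iff:
  assumes "v \<noteq> 0" "w \<noteq> 0"
  shows "proj_of v = proj_of w \<longleftrightarrow> (\<exists>c. c \<noteq> 0 \<and> w = c *s v)"
proof -
  have r: "proj_rel u u" if "u \<noteq> 0" for u :: "complex ^ 'a"
    unfolding proj_rel_def using that by (auto intro: exI[of _ 1])
  have "proj_rel v w \<longleftrightarrow> proj_of v = proj_of w"
    using Quotient_rel[OF Quotient_proj, of v w] r assms by blast
  then show ?thesis unfolding proj_rel_def using assms by blast
qed

lemma proj_of_mem_basic_iff:
  assumes "homogeneous_fun d f" "w \<noteq> 0"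
  shows "proj_of w \<in> {proj_of v | v. v \<noteq> 0 \<and> f v \<noteq> 0} \<longleftrightarrow> f w \<noteq> 0"
proof
  assume "proj_of w \<in> {proj_of v | v. v \<noteq> 0 \<and> f v \<noteq> 0}"
  then obtain v where v: "proj_of w = proj_of v" "v \<noteq> 0" "f v \<noteq> 0" by blast
  with assms(2) obtain c where "v = c *s w" by (auto simp: proj_of_eq_iff)
  then show "f w \<noteq> 0" using v(3) homogeneous_fun_scale[OF assms(1)] by auto
qed (use assms in blast)

lemma openin_zariski_proj_basic:
  "homogeneous_fun d f \<Longrightarrow> openin zariski_proj {proj_of v | v. v \<noteq> 0 \<and> f v \<noteq> 0}"
  unfolding zariski_proj_def by (rule topology_generated_by_Basis) blast

lemma topspace_zariski_proj [simp]: "topspace (zariski_proj :: 'm::finite proj topology) = UNIV"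
proof -
  have "p \<in> topspace zariski_proj" for p :: "'m proj"
  proof -
    obtain v where v: "v \<noteq> 0" "p = proj_of v" by (rule proj_of_cases)
    have "openin zariski_proj {proj_of v | v :: complex ^ 'm. v \<noteq> 0 \<and> (1::complex) \<noteq> 0}"
      by (rule openin_zariski_proj_basic[OF homogeneous_fun_const])
    from openin_subset[OF this] v show ?thesis by auto
  qed
  then show ?thesis by blast
qed

section \<open>A criterion for embeddings into projective space\<close>

text \<open>Clearing denominators is the only tool: every polynomial in the affine coordinates becomes a
  fraction of forms in the homogeneous ones. Applied to the defining polynomial \<open>D\<close> it describes an
  open set containing the image, applied to the coordinates of \<open>Y\<close> it gives closed conditions which
  say that a point agrees with the image of its own candidate preimage, and applied to local
  fractions it shows that the inverse map pulls regular functions back to regular functions.\<close>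

lemma embeds_into_projI:
  fixes D :: "complex ^ 'n \<Rightarrow> complex" and Y :: "complex ^ 'n \<Rightarrow> complex ^ 'm::finite"
  defines "W \<equiv> {x. D x \<noteq> 0}"
  assumes D: "poly_fun D" and Y: "\<And>\<alpha>. poly_fun (\<lambda>x. Y x $ \<alpha>)"
    and nz: "\<And>x. x \<in> W \<Longrightarrow> Y x \<noteq> 0"
    and coord: "\<And>i. forms_ratio W Y (\<lambda>x. x $ i)"
  shows "embeds_into_proj W (\<lambda>x. proj_of (Y x))"
proof -
  let ?\<phi> = "\<lambda>x. proj_of (Y x)"
  obtain d f g where f: "\<And>i. homogeneous_fun (d i) (f i)" and g: "\<And>i. homogeneous_fun (d i) (g i)"
    and fg: "\<And>i x. x \<in> W \<Longrightarrow> g i (Y x) \<noteq> 0 \<and> x $ i = f i (Y x) / g i (Y x)"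
    using coord unfolding forms_ratio_def by metis
  define \<psi> where "\<psi> v = (\<chi> i. f i v / g i v)" for v
  define V where "V = {v. \<forall>i. g i v \<noteq> 0}"
  have \<psi>_Y: "\<psi> (Y x) = x" if "x \<in> W" for x
    using fg[OF that] by (simp add: \<psi>_def vec_eq_iff)
  have Y_V: "Y x \<in> V" if "x \<in> W" for x
    using fg[OF that] by (simp add: V_def)
  have \<psi>_scale: "\<psi> (c *s v) = \<psi> v" if "c \<noteq> 0" for c v
    using that by (simp add: \<psi>_def homogeneous_fun_scale[OF f] homogeneous_fun_scale[OF g])
  have \<psi>_coord: "forms_ratio V (\<lambda>v. v) (\<lambda>v. \<psi> v $ i)" for i
    unfolding forms_ratio_def V_def \<psi>_def using f[of i] g[of i] by auto
  \<comment> \<open>Homogenization, with a denominator that is nonzero on all of \<open>V\<close> and not only on the image.\<close>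
  have pull: "\<exists>e F G. homogeneous_fun e F \<and> homogeneous_fun e G \<and>
      (\<forall>v\<in>V. G v \<noteq> 0 \<and> P (\<psi> v) = F v / G v)" if "poly_fun P" for P
    using forms_ratio_poly_fun[OF that \<psi>_coord] unfolding forms_ratio_def by blast
  have V_form: "homogeneous_fun (\<Sum>i\<in>UNIV. d i) (\<lambda>v. \<Prod>i\<in>UNIV. g i v)"
    by (rule homogeneous_fun_prod) (rule g)
  have V_iff: "v \<in> V \<longleftrightarrow> (\<Prod>i\<in>UNIV. g i v) \<noteq> 0" for v
    by (simp add: V_def)

  \<comment> \<open>The inverse on points: \<open>\<psi>\<close> does not depend on the representative by scale invariance.\<close>
  define \<Psi> where "\<Psi> p = \<psi> (rep_proj p)" for p
  have \<Psi>_proj_of: "\<Psi> (proj_of v) = \<psi> v" if "v \<noteq> 0" for v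
  proof -
    have "proj_rel v v" using that unfolding proj_rel_def by (auto intro: exI[of _ 1])
    then have "proj_rel (rep_proj (proj_of v)) v"
      by (rule Quotient_rep_abs[OF Quotient_proj])
    then show ?thesis unfolding \<Psi>_def proj_rel_def using \<psi>_scale by metis
  qed
  have \<Psi>_\<phi>: "\<Psi> (?\<phi> x) = x" if "x \<in> W" for x
    using that by (simp add: \<Psi>_proj_of nz \<psi>_Y)

  have "locally_closed_in zariski_proj (?\<phi> ` W)"
  proof -
    obtain e F G where e: "homogeneous_fun e F" "homogeneous_fun e G"
      and FG: "\<And>v. v \<in> V \<Longrightarrow> G v \<noteq> 0 \<and> D (\<psi> v) = F v / G v"
      using pull[OF D] by blast
    obtain k A B where k: "\<And>\<alpha>. homogeneous_fun (k \<alpha>) (A \<alpha>)" "\<And>\<alpha>. homogeneous_fun (k \<alpha>) (B \<alpha>)"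
      and AB: "\<And>\<alpha> v. v \<in> V \<Longrightarrow> B \<alpha> v \<noteq> 0 \<and> Y (\<psi> v) $ \<alpha> = A \<alpha> v / B \<alpha> v"
      using pull[OF Y] by metis
    \<comment> \<open>\<open>u\<close> is nonzero exactly where \<open>\<psi> v\<close> is defined and lies in \<open>W\<close>; the \<open>E \<alpha> \<beta>\<close> are the 2 by 2
      minors that express proportionality of \<open>v\<close> and \<open>Y (\<psi> v)\<close>, cleared of denominators.\<close>
    define u where "u v = (\<Prod>i\<in>UNIV. g i v) * F v" for v
    define E where "E \<alpha> \<beta> v = v $ \<alpha> * (A \<beta> v * B \<alpha> v) - v $ \<beta> * (B \<beta> v * A \<alpha> v)" for \<alpha> \<beta> v
    have u: "homogeneous_fun ((\<Sum>i\<in>UNIV. d i) + e) u"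
      unfolding u_def by (intro homogeneous_fun_mult V_form e)
    have E: "homogeneous_fun (1 + (k \<beta> + k \<alpha>)) (E \<alpha> \<beta>)" for \<alpha> \<beta>
      unfolding E_def by (intro homogeneous_fun_diff homogeneous_fun_mult homogeneous_fun_nth k)
    have u_iff: "u v \<noteq> 0 \<longleftrightarrow> v \<in> V \<and> \<psi> v \<in> W" for v
      using FG[of v] by (auto simp: u_def V_iff W_def)
    have E_iff: "E \<alpha> \<beta> v = 0 \<longleftrightarrow> v $ \<alpha> * Y (\<psi> v) $ \<beta> = v $ \<beta> * Y (\<psi> v) $ \<alpha>" if "v \<in> V" for \<alpha> \<beta> v
      using AB[OF that, of \<alpha>] AB[OF that, of \<beta>] by (auto simp: E_def field_simps)
    let ?U = "{proj_of v | v. v \<noteq> 0 \<and> u v \<noteq> 0}"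
    let ?N = "\<Union>\<alpha>. \<Union>\<beta>. {proj_of v | v. v \<noteq> 0 \<and> E \<alpha> \<beta> v \<noteq> 0}"
    have "openin zariski_proj ?U" by (rule openin_zariski_proj_basic[OF u])
    moreover have "openin zariski_proj ?N"
      using openin_zariski_proj_basic[OF E] by blast
    then have "closedin zariski_proj (- ?N)"
      by (simp only: closedin_def topspace_zariski_proj Compl_eq_Diff_UNIV double_diff subset_UNIV simp_thms)
    moreover have "?\<phi> ` W = ?U \<inter> - ?N"
    proof (intro equalityI subsetI)
      fix p assume "p \<in> ?\<phi> ` W"
      then obtain x where x: "x \<in> W" "p = proj_of (Y x)" by blast
      have "u (Y x) \<noteq> 0" and "E \<alpha> \<beta> (Y x) = 0" for \<alpha> \<beta>
        using x(1) Y_V[OF x(1)] \<psi>_Y[OF x(1)] by (simp_all add: u_iff E_iff mult.commute)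
      then show "p \<in> ?U \<inter> - ?N"
        unfolding x(2) using proj_of_mem_basic_iff[OF u nz[OF x(1)]]
          proj_of_mem_basic_iff[OF E nz[OF x(1)]] by blast
    next
      fix p assume p: "p \<in> ?U \<inter> - ?N"
      obtain v where v: "v \<noteq> 0" "p = proj_of v" by (rule proj_of_cases)
      have "proj_of v \<in> ?U" using p unfolding v(2) by (rule IntD1)
      then have uv: "u v \<noteq> 0" by (rule proj_of_mem_basic_iff[OF u v(1), THEN iffD1])
      have "proj_of v \<notin> {proj_of w | w. w \<noteq> 0 \<and> E \<alpha> \<beta> w \<noteq> 0}" for \<alpha> \<beta>
        using IntD2[OF p] unfolding v(2) Compl_iff UN_iff by blast
      then have Ev: "E \<alpha> \<beta> v = 0" for \<alpha> \<beta>
        unfolding proj_of_mem_basic_iff[OF E v(1)] by simp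
      have V: "v \<in> V" and W: "\<psi> v \<in> W" using uv u_iff by auto
      obtain \<beta> where \<beta>: "Y (\<psi> v) $ \<beta> \<noteq> 0" using nz[OF W] by (auto simp: vec_eq_iff)
      define c where "c = v $ \<beta> / Y (\<psi> v) $ \<beta>"
      have c: "v = c *s Y (\<psi> v)"
        using Ev[of _ \<beta>] \<beta> by (simp add: E_iff[OF V] vec_eq_iff c_def field_simps)
      with v(1) have "c \<noteq> 0" by auto
      with c v(1) nz[OF W] have "proj_of (Y (\<psi> v)) = proj_of v"
        by (subst proj_of_eq_iff) auto
      then show "p \<in> ?\<phi> ` W" unfolding v(2) using W by (metis imageI)
    qed
    ultimately show ?thesis unfolding locally_closed_in_def by blast
  qed

  moreover have "morphism (affine_subspace W) (proj_subspace (?\<phi> ` W)) ?\<phi>"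
  proof -
    have cont: "continuous_map (subtopology zariski_affine W) zariski_proj ?\<phi>"
      unfolding zariski_proj_def
    proof (rule continuous_on_generated_topo)
      fix U :: "'m proj set" assume "U \<in> {{proj_of v | v. v \<noteq> 0 \<and> h v \<noteq> 0} | h. \<exists>d. homogeneous_fun d h}"
      then obtain h d where h: "homogeneous_fun d h" and U: "U = {proj_of v | v. v \<noteq> 0 \<and> h v \<noteq> 0}"
        by blast
      have "?\<phi> -` U \<inter> W = W \<inter> {x. h (Y x) \<noteq> 0}"
        unfolding U using proj_of_mem_basic_iff[OF h] nz by blast
      moreover have "openin zariski_affine {x. h (Y x) \<noteq> 0}"
        by (intro openin_zariski_affine_basic poly_fun_compose[OF homogeneous_fun_imp_poly_fun[OF h]] Y)
      ultimately show "openin (subtopology zariski_affine W) (?\<phi> -` U \<inter> topspace (subtopology zariski_affine W))"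
        by (simp add: openin_subtopology_Int2)
    next
      show "?\<phi> ` topspace (subtopology zariski_affine W) \<subseteq>
          \<Union>{{proj_of v | v. v \<noteq> 0 \<and> h v \<noteq> 0} | h. \<exists>d. homogeneous_fun d h}"
        using topspace_zariski_proj[where 'm='m]
        unfolding zariski_proj_def topology_generated_by_topspace by simp
    qed
    have W_open: "openin zariski_affine W"
      unfolding W_def by (rule openin_zariski_affine_basic[OF D])
    have "regular_affine {x \<in> W. ?\<phi> x \<in> S} (h \<circ> ?\<phi>)"
      if S: "openin (subtopology zariski_proj (?\<phi> ` W)) S" and h: "regular_proj S h" for S h
      unfolding regular_affine_def
    proof
      fix p assume p: "p \<in> {x \<in> W. ?\<phi> x \<in> S}"
      then obtain e a b U where ab: "homogeneous_fun e a" "homogeneous_fun e b"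
        and U: "openin zariski_proj U" "?\<phi> p \<in> U"
        and eq: "\<And>v. v \<noteq> 0 \<Longrightarrow> proj_of v \<in> S \<inter> U \<Longrightarrow> b v \<noteq> 0 \<and> h (proj_of v) = a v / b v"
        using h unfolding regular_proj_def by blast
      have "openin (subtopology zariski_affine W) {x \<in> W. ?\<phi> x \<in> U}"
        using openin_continuous_map_preimage[OF cont U(1)] by simp
      then have "openin zariski_affine {x \<in> W. ?\<phi> x \<in> U}"
        using W_open by (rule openin_trans_full)
      moreover have "poly_fun (\<lambda>x. a (Y x))" "poly_fun (\<lambda>x. b (Y x))"
        by (rule poly_fun_compose[OF homogeneous_fun_imp_poly_fun Y], rule ab)+
      ultimately show "\<exists>f g U. poly_fun f \<and> poly_fun g \<and> openin zariski_affine U \<and> p \<in> U \<and>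
          (\<forall>x\<in>{x \<in> W. ?\<phi> x \<in> S} \<inter> U. g x \<noteq> 0 \<and> (h \<circ> ?\<phi>) x = f x / g x)"
        using p U(2) eq nz
        by (intro exI[of _ "\<lambda>x. a (Y x)"] exI[of _ "\<lambda>x. b (Y x)"] exI[of _ "{x \<in> W. ?\<phi> x \<in> U}"]) auto
    qed
    then show ?thesis
      using cont by (auto simp: morphism_def affine_subspace_def proj_subspace_def
          continuous_map_in_subtopology)
  qed

  moreover have "morphism (proj_subspace (?\<phi> ` W)) (affine_subspace W) \<Psi>"
  proof -
    have cont: "continuous_map (subtopology zariski_proj (?\<phi> ` W)) zariski_affine \<Psi>"
      unfolding zariski_affine_def
    proof (rule continuous_on_generated_topo)
      fix U :: "(complex ^ 'n) set" assume "U \<in> {{x. h x \<noteq> 0} | h. poly_fun h}"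
      then obtain h where h: "poly_fun h" and U: "U = {x. h x \<noteq> 0}" by blast
      obtain e F G where e: "homogeneous_fun e F"
        and FG: "\<And>v. v \<in> V \<Longrightarrow> G v \<noteq> 0 \<and> h (\<psi> v) = F v / G v"
        using pull[OF h] by blast
      have "\<Psi> -` U \<inter> ?\<phi> ` W = ?\<phi> ` W \<inter> {proj_of v | v. v \<noteq> 0 \<and> F v \<noteq> 0}"
      proof -
        have "\<Psi> (?\<phi> x) \<in> U \<longleftrightarrow> ?\<phi> x \<in> {proj_of v | v. v \<noteq> 0 \<and> F v \<noteq> 0}" if "x \<in> W" for x
          unfolding proj_of_mem_basic_iff[OF e nz[OF that]]
          using FG[OF Y_V[OF that]] by (simp add: \<Psi>_proj_of nz[OF that] U)
        then show ?thesis by blast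
      qed
      then show "openin (subtopology zariski_proj (?\<phi> ` W)) (\<Psi> -` U \<inter> topspace (subtopology zariski_proj (?\<phi> ` W)))"
        using openin_zariski_proj_basic[OF e] by (simp add: openin_subtopology_Int2)
    next
      show "\<Psi> ` topspace (subtopology zariski_proj (?\<phi> ` W)) \<subseteq> \<Union>{{x. h x \<noteq> 0} | h. poly_fun h}"
        using topspace_zariski_affine[where 'a='n]
        unfolding zariski_affine_def topology_generated_by_topspace by simp
    qed
    have "regular_proj {y \<in> ?\<phi> ` W. \<Psi> y \<in> S} (h \<circ> \<Psi>)"
      if S: "openin (subtopology zariski_affine W) S" and h: "regular_affine S h" for S h
      unfolding regular_proj_def
    proof
      fix p assume p: "p \<in> {y \<in> ?\<phi> ` W. \<Psi> y \<in> S}"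
      then obtain a b U where ab: "poly_fun a" "poly_fun b"
        and U: "openin zariski_affine U" "\<Psi> p \<in> U"
        and eq: "\<And>x. x \<in> S \<inter> U \<Longrightarrow> b x \<noteq> 0 \<and> h x = a x / b x"
        using h unfolding regular_affine_def by blast
      have "openin (subtopology zariski_proj (?\<phi> ` W)) {y \<in> ?\<phi> ` W. \<Psi> y \<in> U}"
        using openin_continuous_map_preimage[OF cont U(1)] by simp
      then obtain T where T: "openin zariski_proj T" "{y \<in> ?\<phi> ` W. \<Psi> y \<in> U} = T \<inter> ?\<phi> ` W"
        unfolding openin_subtopology by blast
      obtain k A B where k: "homogeneous_fun k A" "homogeneous_fun k B"
        and AB: "\<And>v. v \<in> V \<Longrightarrow> B v \<noteq> 0 \<and> a (\<psi> v) = A v / B v"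
        using pull[OF ab(1)] by blast
      obtain l K L where l: "homogeneous_fun l K" "homogeneous_fun l L"
        and KL: "\<And>v. v \<in> V \<Longrightarrow> L v \<noteq> 0 \<and> b (\<psi> v) = K v / L v"
        using pull[OF ab(2)] by blast
      have "homogeneous_fun (k + l) (\<lambda>v. A v * L v)" "homogeneous_fun (k + l) (\<lambda>v. B v * K v)"
        by (intro homogeneous_fun_mult k l)+
      moreover have "p \<in> T" using p U(2) T(2) by blast
      moreover have "B v * K v \<noteq> 0 \<and> (h \<circ> \<Psi>) (proj_of v) = A v * L v / (B v * K v)"
        if v: "v \<noteq> 0" "proj_of v \<in> {y \<in> ?\<phi> ` W. \<Psi> y \<in> S} \<inter> T" for v
      proof -
        have "proj_of v \<in> ?\<phi> ` W" "\<Psi> (proj_of v) \<in> S \<inter> U" using v(2) T(2) by blast+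
        then obtain x where x: "x \<in> W" "proj_of (Y x) = proj_of v" and "\<psi> v \<in> S \<inter> U"
          by (auto simp: \<Psi>_proj_of v(1))
        obtain c where "c \<noteq> 0" "v = c *s Y x" using x nz v(1) by (auto simp: proj_of_eq_iff)
        then have "v \<in> V"
          using Y_V[OF x(1)] by (simp add: V_def homogeneous_fun_scale[OF g])
        then show ?thesis
          using eq[OF \<open>\<psi> v \<in> S \<inter> U\<close>] AB[of v] KL[of v] by (simp add: \<Psi>_proj_of v(1))
      qed
      ultimately show "\<exists>d f g U. homogeneous_fun d f \<and> homogeneous_fun d g \<and> openin zariski_proj U \<and> p \<in> U \<and>
          (\<forall>v. v \<noteq> 0 \<and> proj_of v \<in> {y \<in> ?\<phi> ` W. \<Psi> y \<in> S} \<inter> U \<longrightarrow>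
            g v \<noteq> 0 \<and> (h \<circ> \<Psi>) (proj_of v) = f v / g v)"
        using T(1) by blast
    qed
    then show ?thesis
      using cont \<Psi>_\<phi> by (auto simp: morphism_def affine_subspace_def proj_subspace_def
          continuous_map_in_subtopology)
  qed

  ultimately show ?thesis
    unfolding embeds_into_proj_def isomorphism_def
    using \<Psi>_\<phi> by (auto intro!: exI[of _ \<Psi>] simp: affine_subspace_def proj_subspace_def)
qed

section \<open>The forty coordinates on the moduli space\<close>

lemma exhaust_6:
  fixes i :: 6
  shows "i = 1 \<or> i = 2 \<or> i = 3 \<or> i = 4 \<or> i = 5 \<or> i = 6"
proof (induct i)
  case (of_int z)
  then have "z = 0 \<or> z = 1 \<or> z = 2 \<or> z = 3 \<or> z = 4 \<or> z = 5" by fastforce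
  then show ?case by auto
qed

lemma sum_6: "sum h (UNIV :: 6 set) = h 1 + h 2 + h 3 + h 4 + h 5 + h 6"
proof -
  have UNIV_6: "UNIV = {1, 2, 3, 4, 5, 6 :: 6}" using exhaust_6 by auto
  show ?thesis unfolding UNIV_6 by (simp add: ac_simps)
qed

text \<open>The entries of \<open>vector\<close> are read off a \<open>foldr\<close> that carries the current index, hence the
  induction over all start indices.\<close>

lemma poly_fun_vector_nth:
  assumes "\<And>j. poly_fun (h j)"
  shows "poly_fun (\<lambda>x. (vector (map (\<lambda>j. h j x) l) :: complex ^ 'k::{finite,one,plus}) $ k)"
proof -
  have "poly_fun (\<lambda>x. foldr (\<lambda>a F n. (F (n + 1))(n := a)) (map (\<lambda>j. h j x) l) (\<lambda>n k. 0) n k)"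
    for n k
  proof (induction l arbitrary: n)
    case Nil
    show ?case by (simp add: poly_fun_const)
  next
    case (Cons j l)
    then show ?case by (cases "k = n") (simp_all add: assms)
  qed
  then show ?thesis by (simp add: vector_def)
qed

lemma poly_fun_config_matrix: "poly_fun (\<lambda>x. config_matrix x $ r $ j)"
  using exhaust_3[of r] exhaust_6[of j]
  by (elim disjE) (simp_all add: config_matrix_def vector_6_nth poly_fun_const poly_fun_nth)

lemma poly_fun_ycoords: "poly_fun (\<lambda>x. ycoords (config_matrix x) $ \<alpha>)"
proof -
  have minor: "poly_fun (\<lambda>x. minor T (config_matrix x))" for T
    unfolding minor_def
    by (rule poly_fun_det) (simp add: poly_fun_vector_nth poly_fun_config_matrix)
  have conic: "poly_fun (\<lambda>x. conic_det (config_matrix x))"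
    unfolding conic_det_def
  proof (rule poly_fun_det)
    fix r j :: 6
    show "poly_fun (\<lambda>x. (\<chi> r (j :: 6). (vector
      [config_matrix x $ 1 $ j * config_matrix x $ 2 $ j, config_matrix x $ 2 $ j * config_matrix x $ 3 $ j,
       config_matrix x $ 3 $ j * config_matrix x $ 1 $ j,
       (config_matrix x $ 1 $ j)\<^sup>2, (config_matrix x $ 2 $ j)\<^sup>2, (config_matrix x $ 3 $ j)\<^sup>2] :: complex ^ 6) $ r) $ r $ j)"
      using exhaust_6[of r]
      by (elim disjE) (simp_all add: vector_6_nth poly_fun_mult poly_fun_power poly_fun_config_matrix)
  qed
  show ?thesis
    by (cases "Rep_label \<alpha>")
       (auto simp: ycoords_def ycoord_def case_prod_beta
         intro!: poly_fun_mult poly_fun_prod minor conic)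
qed

lemma poly_fun_cubic_disc: "poly_fun cubic_disc"
  unfolding cubic_disc_def[abs_def] Let_def
  by (intro poly_fun_mult poly_fun_add poly_fun_diff poly_fun_uminus poly_fun_const poly_fun_nth)

text \<open>As a rewrite rule this sorts explicit sets of numerals, as far as the simplifier's term order
  on numerals agrees with the numerical one.\<close>

lemma insert_sort: "(j :: nat) < i \<Longrightarrow> insert i (insert j S) = insert j (insert i S)"
  by (rule insert_commute)

lemma minor_config_matrix:
  fixes x :: "complex ^ 4"
  defines "X \<equiv> config_matrix x"
  shows "minor {1,2,3} X = 1" "minor {1,2,4} X = 1" "minor {1,2,5} X = x $ 3" "minor {1,2,6} X = x $ 4"
    "minor {1,3,4} X = - 1" "minor {1,3,5} X = - x $ 1" "minor {1,3,6} X = - x $ 2"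
    "minor {1,4,5} X = - (x $ 1 - x $ 3)" "minor {1,4,6} X = - (x $ 2 - x $ 4)"
    "minor {1,5,6} X = x $ 1 * x $ 4 - x $ 2 * x $ 3"
    "minor {2,3,4} X = 1" "minor {2,3,5} X = 1" "minor {2,3,6} X = 1"
    "minor {2,4,5} X = - (x $ 3 - 1)" "minor {2,4,6} X = - (x $ 4 - 1)" "minor {2,5,6} X = x $ 3 - x $ 4"
    "minor {3,4,5} X = x $ 1 - 1" "minor {3,4,6} X = x $ 2 - 1" "minor {3,5,6} X = - (x $ 1 - x $ 2)"
    "minor {4,5,6} X = x $ 1 * x $ 4 - x $ 4 + x $ 2 - x $ 2 * x $ 3 + x $ 3 - x $ 1"
  unfolding X_def
  by (simp_all add: minor_sorted det_3 config_matrix_def vector_6_nth algebra_simps)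

lemma cubic_moduliD:
  assumes "x \<in> cubic_moduli"
  shows "x $ 1 \<noteq> 0" "x $ 2 \<noteq> 0" "x $ 3 \<noteq> 0" "x $ 4 \<noteq> 0"
    "x $ 1 - 1 \<noteq> 0" "x $ 2 - 1 \<noteq> 0" "x $ 3 - 1 \<noteq> 0" "x $ 4 - 1 \<noteq> 0"
    "x $ 1 - x $ 2 \<noteq> 0" "x $ 1 - x $ 3 \<noteq> 0" "x $ 2 - x $ 4 \<noteq> 0" "x $ 3 - x $ 4 \<noteq> 0"
    "x $ 1 * x $ 4 - x $ 2 * x $ 3 \<noteq> 0"
    "x $ 1 * x $ 4 - x $ 4 + x $ 2 - x $ 2 * x $ 3 + x $ 3 - x $ 1 \<noteq> 0"
    "- x $ 1 * x $ 2 * x $ 3 - x $ 2 * x $ 3 * x $ 4 + x $ 2 * x $ 3 + x $ 1 * x $ 2 * x $ 4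
      + x $ 1 * x $ 3 * x $ 4 - x $ 1 * x $ 4 \<noteq> 0"
  using assms unfolding cubic_moduli_def mem_Collect_eq cubic_disc_def Let_def mult_eq_0_iff de_Morgan_disj
  by blast+

text \<open>No three of the six points are collinear. Each minor is, up to sign, either 1 or a factor of
  the discriminant.\<close>

lemma minor_nonzero:
  assumes x: "x \<in> cubic_moduli" and T: "T \<subseteq> {1..6}" "card T = 3"
  shows "minor T (config_matrix x) \<noteq> 0"
proof -
  obtain i j k where ijk: "T = {i,j,k}" "i < j" "j < k"
  proof -
    obtain i j k where *: "T = {i,j,k}" "i \<noteq> j" "j \<noteq> k" "i \<noteq> k" using T(2) by (auto simp: card_3_iff)
    have perms: "{i,k,j} = {i,j,k}" "{j,i,k} = {i,j,k}" "{j,k,i} = {i,j,k}" "{k,i,j} = {i,j,k}"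
      "{k,j,i} = {i,j,k}" by blast+
    consider "i < j" "j < k" | "i < k" "k < j" | "j < i" "i < k" | "j < k" "k < i" | "k < i" "i < j"
      | "k < j" "j < i" using *(2-4) by linarith
    then show thesis using that * perms by cases metis+
  qed
  then have b: "1 \<le> i" "k \<le> 6" using T(1) by auto
  have "i = 1 \<or> i = 2 \<or> i = 3 \<or> i = 4" "j = 2 \<or> j = 3 \<or> j = 4 \<or> j = 5"
    "k = 3 \<or> k = 4 \<or> k = 5 \<or> k = 6"
    using ijk(2,3) b by linarith+
  then have "i = 1 \<and> j = 2 \<and> k = 3 \<or> i = 1 \<and> j = 2 \<and> k = 4 \<or> i = 1 \<and> j = 2 \<and> k = 5 \<or> i = 1 \<and> j = 2 \<and> k = 6
    \<or> i = 1 \<and> j = 3 \<and> k = 4 \<or> i = 1 \<and> j = 3 \<and> k = 5 \<or> i = 1 \<and> j = 3 \<and> k = 6 \<or> i = 1 \<and> j = 4 \<and> k = 5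
    \<or> i = 1 \<and> j = 4 \<and> k = 6 \<or> i = 1 \<and> j = 5 \<and> k = 6 \<or> i = 2 \<and> j = 3 \<and> k = 4 \<or> i = 2 \<and> j = 3 \<and> k = 5
    \<or> i = 2 \<and> j = 3 \<and> k = 6 \<or> i = 2 \<and> j = 4 \<and> k = 5 \<or> i = 2 \<and> j = 4 \<and> k = 6 \<or> i = 2 \<and> j = 5 \<and> k = 6
    \<or> i = 3 \<and> j = 4 \<and> k = 5 \<or> i = 3 \<and> j = 4 \<and> k = 6 \<or> i = 3 \<and> j = 5 \<and> k = 6 \<or> i = 4 \<and> j = 5 \<and> k = 6"
    using ijk(2,3) by (elim disjE) simp_all
  then show ?thesis
    unfolding ijk(1)
    by (elim disjE conjE) (simp_all only: minor_config_matrix neg_equal_0_iff_equal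
        cubic_moduliD[OF x] one_neq_zero simp_thms)
qed

text \<open>A left kernel vector of the matrix of \<open>conic_det\<close> is a conic through the six points. Passing
  through the three coordinate points kills its squares, and the other three points impose on the
  remaining coefficients a linear system whose determinant is the last factor of the discriminant.
  This avoids expanding a determinant of size six.\<close>

lemma conic_det_nonzero:
  assumes "x \<in> cubic_moduli"
  shows "conic_det (config_matrix x) \<noteq> 0"
proof
  let ?p = "\<lambda>r j. config_matrix x $ r $ j"
  define A :: "complex ^ 6 ^ 6" where "A = (\<chi> r j. (vector
      [?p 1 j * ?p 2 j, ?p 2 j * ?p 3 j, ?p 3 j * ?p 1 j,
       (?p 1 j)\<^sup>2, (?p 2 j)\<^sup>2, (?p 3 j)\<^sup>2] :: complex ^ 6) $ r)"
  assume "conic_det (config_matrix x) = 0"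
  then have "det (transpose A) = 0" unfolding conic_det_def A_def by (simp add: det_transpose)
  then have "\<not> (\<exists>B. B ** transpose A = mat 1)"
    using invertible_det_nz invertible_left_inverse by blast
  then obtain v where v: "transpose A *v v = 0" "v \<noteq> 0"
    unfolding matrix_left_invertible_ker by blast
  have "(\<Sum>r\<in>UNIV. A $ r $ j * v $ r) = 0" for j
    using v(1) by (simp add: vec_eq_iff matrix_vector_mult_def transpose_def)
  then have through: "v $ 1 * (?p 1 j * ?p 2 j) + v $ 2 * (?p 2 j * ?p 3 j) + v $ 3 * (?p 3 j * ?p 1 j)
      + v $ 4 * (?p 1 j)\<^sup>2 + v $ 5 * (?p 2 j)\<^sup>2 + v $ 6 * (?p 3 j)\<^sup>2 = 0" for j
    by (simp add: sum_6 A_def vector_6_nth mult.commute)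
  note pts = config_matrix_def vector_6_nth
  have sq: "v $ 4 = 0" "v $ 5 = 0" "v $ 6 = 0"
    using through[of 1] through[of 2] through[of 3] by (simp_all add: pts)
  let ?a = "v $ 1" and ?b = "v $ 2" and ?c = "v $ 3"
  have e: "?a + ?b + ?c = 0" "?a * x $ 1 + ?b * (x $ 1 * x $ 3) + ?c * x $ 3 = 0"
    "?a * x $ 2 + ?b * (x $ 2 * x $ 4) + ?c * x $ 4 = 0"
    using through[of 4] through[of 5] through[of 6] by (simp_all add: pts sq)
  let ?Q = "- x $ 1 * x $ 2 * x $ 3 - x $ 2 * x $ 3 * x $ 4 + x $ 2 * x $ 3 + x $ 1 * x $ 2 * x $ 4
      + x $ 1 * x $ 3 * x $ 4 - x $ 1 * x $ 4"
  have "?Q * ?a = 0" "?Q * ?b = 0" "?Q * ?c = 0" using e by algebra+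
  then have "?a = 0" "?b = 0" "?c = 0" using cubic_moduliD(15)[OF assms] by simp_all
  then have "v = 0" unfolding vec_eq_iff using sq exhaust_6 by (metis zero_index)
  with v(2) show False by simp
qed

lemma ycoords_nth_nonzero:
  assumes x: "x \<in> cubic_moduli"
  shows "ycoords (config_matrix x) $ \<alpha> \<noteq> 0"
proof -
  have nz: "minor {i,j,k} (config_matrix x) \<noteq> 0" if "i \<in> {1..6}" "j \<in> {1..6}" "k \<in> {1..6}"
      "i \<noteq> j" "j \<noteq> k" "i \<noteq> k" for i j k
    using that by (intro minor_nonzero[OF x]) auto
  show ?thesis
  proof (cases \<alpha> rule: label_cases)
    case (1 a b c d e f)
    have m: "a \<in> {1..6}" "b \<in> {1..6}" "c \<in> {1..6}" "d \<in> {1..6}" "e \<in> {1..6}" "f \<in> {1..6}"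
      unfolding 1(1)[symmetric] by blast+
    have "distinct [a,b,c,d,e,f]" by (rule distinct6[OF 1(1)])
    moreover from this have "distinct [f,e,d,c,b,a]" by auto
    ultimately show ?thesis using m
      by (simp add: ycoords_def 1(2) ycoord_label33[OF 1(1)] conic_det_nonzero[OF x] nz
          del: atLeastAtMost_iff)
  next
    case (2 a b c d e f)
    have m: "a \<in> {1..6}" "b \<in> {1..6}" "c \<in> {1..6}" "d \<in> {1..6}" "e \<in> {1..6}" "f \<in> {1..6}"
      unfolding 2(1)[symmetric] by blast+
    have "distinct [a,b,c,d,e,f]" by (rule distinct6[OF 2(1)])
    moreover from this have "distinct [f,e,d,c,b,a]" by auto
    ultimately show ?thesis using m
      by (simp add: ycoords_def 2(2) ycoord_label222[OF 2(1)] nz del: atLeastAtMost_iff)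
  qed
qed

lemma columns_1_to_6: "{1..6} = {1,2,3,4,5,6 :: nat}"
  by auto

text \<open>The value of \<open>conic_det\<close> is left unevaluated, because it cancels from every ratio in which as
  many labels of the type \<open>(abc,def)\<close> occur above as below.\<close>

lemma ycoords_values:
  fixes x :: "complex ^ 4"
  defines "y \<equiv> ($) (ycoords (config_matrix x))" and "q \<equiv> conic_det (config_matrix x)"
    and "D1 \<equiv> x $ 1 * x $ 4 - x $ 2 * x $ 3"
    and "D2 \<equiv> x $ 1 * x $ 4 - x $ 4 + x $ 2 - x $ 2 * x $ 3 + x $ 3 - x $ 1"
  shows "y (label33 1 2 3 4 5 6) = D2 * q"
    "y (label33 1 5 6 2 3 4) = D1 * q"
    "y (label33 1 3 4 2 5 6) = - ((x $ 3 - x $ 4) * q)"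
    "y (label33 1 4 5 2 3 6) = - ((x $ 1 - x $ 3) * q)"
    "y (label33 1 4 6 2 3 5) = - ((x $ 2 - x $ 4) * q)"
    "y (label33 1 3 5 2 4 6) = x $ 1 * (x $ 4 - 1) * q"
    "y (label33 1 3 6 2 4 5) = x $ 2 * (x $ 3 - 1) * q"
    "y (label222 1 3 2 4 5 6) = x $ 1 * x $ 2 * (x $ 3 - x $ 4) * D2"
    "y (label222 1 4 5 6 2 3) = - (D1 * D2)"
    "y (label222 1 5 3 6 2 4) = x $ 2 * x $ 3 * (x $ 4 - 1) * (x $ 1 - x $ 2) * (x $ 1 - x $ 3)"
    "y (label222 1 3 2 5 4 6) = - (x $ 2 * x $ 3 * (x $ 4 - 1) * D2)"
    "y (label222 1 5 2 6 3 4) = x $ 1 * x $ 4 * (x $ 2 - 1) * (x $ 1 - x $ 3) * (x $ 3 - x $ 4)"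
    "y (label222 1 2 3 5 4 6) = - (x $ 1 * x $ 4 * (x $ 2 - 1) * D2)"
    "y (label222 1 6 2 5 3 4) = x $ 2 * x $ 3 * (x $ 1 - 1) * (x $ 2 - x $ 4) * (x $ 3 - x $ 4)"
    "y (label222 1 2 3 6 4 5) = - (x $ 2 * x $ 3 * (x $ 1 - 1) * D2)"
    "y (label222 1 3 2 6 4 5) = - (x $ 1 * x $ 4 * (x $ 3 - 1) * D2)"
  unfolding y_def q_def D1_def D2_def ycoords_def
  \<comment> \<open>The label formulas need their six entries to exhaust \<open>{1..6}\<close>, and the minors are listed
    for increasing columns; both are reached by sorting the sets. The instance for \<open>6\<close> and \<open>5\<close>
    is separate because the simplifier applies a permutative rule such as \<open>insert_sort\<close> only
    along its own term order, which puts the numeral \<open>6\<close> before \<open>5\<close>.\<close>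
  by (simp_all add: ycoord_label33 ycoord_label222 columns_1_to_6 insert_sort insert_commute[of 6 5]
      minor_config_matrix del: One_nat_def minus_diff_eq)

text \<open>Six functions of weight divisible by 3, in the sense explained at the beginning, are written as
  products of ratios of the \<open>y\<close>. Each product is a shortest relation
  between the exponent vectors that the \<open>y\<close> have in the fifteen factors of the discriminant.\<close>

lemma forms_ratio_coordinate:
  "forms_ratio cubic_moduli (\<lambda>x. ycoords (config_matrix x)) (\<lambda>x. x $ i)"
proof -
  let ?Y = "\<lambda>x. ycoords (config_matrix x)"
  let ?R = "forms_ratio cubic_moduli ?Y"
  have ratio: "?R (\<lambda>x. ?Y x $ \<alpha> / ?Y x $ \<beta>)" for \<alpha> \<beta>
    by (rule forms_ratio_nth) (rule ycoords_nth_nonzero)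
  note vals = ycoords_values cubic_moduliD conic_det_nonzero
  have s: "?R (\<lambda>x. x $ 1 - x $ 2)"
    by (rule forms_ratio_cong, rule forms_ratio_mult,
        rule ratio[of "label33 1 2 3 4 5 6" "label33 1 4 5 2 3 6"],
        rule ratio[of "label222 1 5 3 6 2 4" "label222 1 3 2 5 4 6"])
       (simp add: vals del: One_nat_def right_minus_eq minus_diff_eq )
  have s13: "?R (\<lambda>x. x $ 1 - x $ 3)"
    by (rule forms_ratio_cong, rule forms_ratio_mult,
        rule ratio[of "label33 1 2 3 4 5 6" "label33 1 3 4 2 5 6"],
        rule ratio[of "label222 1 5 2 6 3 4" "label222 1 2 3 5 4 6"])
       (simp add: vals del: One_nat_def right_minus_eq minus_diff_eq)
  have s24: "?R (\<lambda>x. x $ 2 - x $ 4)"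
    by (rule forms_ratio_cong, rule forms_ratio_mult,
        rule ratio[of "label33 1 2 3 4 5 6" "label33 1 3 4 2 5 6"],
        rule ratio[of "label222 1 6 2 5 3 4" "label222 1 2 3 6 4 5"])
       (simp add: vals del: One_nat_def right_minus_eq minus_diff_eq)
  have r: "?R (\<lambda>x. x $ 1 * x $ 2)"
    by (rule forms_ratio_cong, rule forms_ratio_mult,
        rule ratio[of "label33 1 5 6 2 3 4" "label33 1 3 4 2 5 6"],
        rule ratio[of "label222 1 3 2 4 5 6" "label222 1 4 5 6 2 3"])
       (simp add: vals del: One_nat_def right_minus_eq minus_diff_eq)
  have p1: "?R (\<lambda>x. - (x $ 1 * (x $ 1 - 1)))"
    by (rule forms_ratio_cong, rule forms_ratio_mult, rule forms_ratio_mult,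
        rule ratio[of "label33 1 2 3 4 5 6" "label33 1 3 4 2 5 6"],
        rule ratio[of "label33 1 3 5 2 4 6" "label33 1 4 6 2 3 5"],
        rule ratio[of "label222 1 6 2 5 3 4" "label222 1 3 2 5 4 6"])
       (simp add: vals del: One_nat_def right_minus_eq minus_diff_eq)
  have p2: "?R (\<lambda>x. - (x $ 2 * (x $ 2 - 1)))"
    by (rule forms_ratio_cong, rule forms_ratio_mult, rule forms_ratio_mult,
        rule ratio[of "label33 1 2 3 4 5 6" "label33 1 3 4 2 5 6"],
        rule ratio[of "label33 1 3 6 2 4 5" "label33 1 4 5 2 3 6"],
        rule ratio[of "label222 1 5 2 6 3 4" "label222 1 3 2 6 4 5"])
       (simp add: vals del: One_nat_def right_minus_eq minus_diff_eq)
  \<comment> \<open>The squares cancel and only the linear part \<open>x1 + x2\<close> survives.\<close>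
  have "?R (\<lambda>x. (x $ 1 - x $ 2) * (x $ 1 - x $ 2) + 2 * (x $ 1 * x $ 2)
      + - (x $ 1 * (x $ 1 - 1)) + - (x $ 2 * (x $ 2 - 1)))"
    by (intro forms_ratio_add forms_ratio_mult forms_ratio_const s r p1 p2)
  then have sum: "?R (\<lambda>x. x $ 1 + x $ 2)"
    by (rule forms_ratio_cong) (simp add: algebra_simps)
  have "?R (\<lambda>x. 1 / 2 * ((x $ 1 + x $ 2) + (x $ 1 - x $ 2)))"
    by (intro forms_ratio_add forms_ratio_mult forms_ratio_const s sum)
  then have x1: "?R (\<lambda>x. x $ 1)" by simp
  have x2: "?R (\<lambda>x. x $ 2)" using forms_ratio_diff[OF x1 s] by simp
  have x3: "?R (\<lambda>x. x $ 3)" using forms_ratio_diff[OF x1 s13] by simp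
  have x4: "?R (\<lambda>x. x $ 4)" using forms_ratio_diff[OF x2 s24] by simp
  show ?thesis using exhaust_4[of i] x1 x2 x3 x4 by blast
qed

theorem theorem2:
  shows "embeds_into_proj cubic_moduli phi"
proof -
  have "embeds_into_proj {x. cubic_disc x \<noteq> 0} (\<lambda>x. proj_of (ycoords (config_matrix x)))"
    using ycoords_nonzero forms_ratio_coordinate
    by (intro embeds_into_projI poly_fun_cubic_disc poly_fun_ycoords) (simp_all add: cubic_moduli_def)
  then show ?thesis unfolding cubic_moduli_def phi_def[abs_def] .
qed

end
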